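(* Let $X$ be a normed linear space, let $Y$ be the dual space of some separable Banach space, and let $T : X \to Y$ be a bounded linear operator. Let $(P_n)$ be a sequence of bounded linear operators on $X$ and $(Q_n)$ a sequence of bounded linear operators on $Y$ such that $\|Q_n\|\,\|P_n\| \le 1$ for each $n \in \mathbb{N}$, and let $T_n := Q_n T P_n$. If $T_n \to T$ in the weak operator topology on the space of bounded linear operators from $X$ to $Y$ (that is, $f(T_n x) \to f(Tx)$ for every $x \in X$ and every bounded linear functional $f$ on $Y$), then for each $k \in \mathbb{N}$, $$\lim_{n\to\infty} \epsilon_k(T_n) = \epsilon_k(T).$$
   Context: For normed linear spaces $X, Y$ and a bounded linear operator $S : X \to Y$, let $U_X = \{x \in X : \|x\| \le 1\}$ be the closed unit ball of $X$ and, for $y_0 \in Y$ and $r>0$, let $U(y_0,r) = \{y \in Y : \|y-y_0\| \le r\}$. For $k \in \mathbb{N} = \{1,2,\dots\}$, the $k$-th entropy number of $S$ is $$\epsilon_k(S) := \inf\Big\{\epsilon>0 : \text{there exist } j \le k \text{ and } y_1,\dots,y_j \in Y \text{ such that } S(U_X) \subseteq \bigcup_{i=1}^j U(y_i,\epsilon)\Big\}.$$ The dual space of a Banach space carries its usual dual norm. *)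

theory Defs
  imports "HOL-Analysis.Analysis"
begin

text \<open>
  The scalar field is a type of class \<open>{real_normed_field, heine_borel}\<close>. By Gelfand-Mazur, up to
  isomorphism exactly \<open>real\<close> and \<open>complex\<close> qualify, so real and complex spaces are both covered.
  The library only has real normed spaces, hence the scalar multiplication is an explicit argument
  \<open>s\<close>, required to extend \<open>scaleR\<close> and to be compatible with the norm. For real scalars,
  \<open>s = scaleR\<close>.
\<close>

locale normed_space_over = vector_space s
  for s :: "'k::{real_normed_field,heine_borel} \<Rightarrow> 'v::real_normed_vector \<Rightarrow> 'v" +
  assumes scale_of_real: "s (of_real r) x = r *\<^sub>R x"
    and norm_scale: "norm (s c x) = norm c * norm x"

lemma normed_space_over_scaleR:
  "normed_space_over (scaleR :: real \<Rightarrow> 'v::real_normed_vector \<Rightarrow> 'v)"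
  by unfold_locales (auto simp: scaleR_add_right scaleR_add_left)

lemma normed_space_over_mult:
  "normed_space_over ((*) :: 'k::{real_normed_field,heine_borel} \<Rightarrow> 'k \<Rightarrow> 'k)"
  by unfold_locales (auto simp: algebra_simps norm_mult scaleR_conv_of_real)

text \<open>
  The type \<open>'a \<Rightarrow>\<^sub>L 'b\<close> consists of the bounded operators that are linear over the reals. Linearity
  over the scalar field is automatic only for real scalars.
\<close>

definition bounded_operator ::
  "('k::{real_normed_field,heine_borel} \<Rightarrow> 'a::real_normed_vector \<Rightarrow> 'a) \<Rightarrow>
   ('k \<Rightarrow> 'b::real_normed_vector \<Rightarrow> 'b) \<Rightarrow> ('a \<Rightarrow>\<^sub>L 'b) \<Rightarrow> bool"
  where "bounded_operator s t S \<longleftrightarrow> Vector_Spaces.linear s t (blinfun_apply S)"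

lemma bounded_operator_scaleR: "bounded_operator scaleR scaleR S"
  unfolding bounded_operator_def
  using blinfun.bounded_linear_right[THEN bounded_linear.linear, of S]
  by (simp add: linear_def)

text \<open>
  \<open>is_dual_via sY sZ \<Phi>\<close>: the map \<open>\<Phi>\<close> identifies \<open>'y\<close>, isometrically and linearly over the scalar
  field, with the space of all bounded linear functionals on \<open>'z\<close> under the operator norm. For real
  scalars one may take \<open>'y = 'z \<Rightarrow>\<^sub>L real\<close> and \<open>\<Phi> = id\<close>. For other scalars the functionals are only
  a subset of the type \<open>'z \<Rightarrow>\<^sub>L 'k\<close>, hence the identification map.
\<close>

definition is_dual_via ::
  "('k::{real_normed_field,heine_borel} \<Rightarrow> 'y::real_normed_vector \<Rightarrow> 'y) \<Rightarrow>
   ('k \<Rightarrow> 'z::real_normed_vector \<Rightarrow> 'z) \<Rightarrow> ('y \<Rightarrow> 'z \<Rightarrow>\<^sub>L 'k) \<Rightarrow> bool"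
  where "is_dual_via sY sZ \<Phi> \<longleftrightarrow>
    (\<forall>y y'. \<Phi> (y + y') = \<Phi> y + \<Phi> y') \<and>
    (\<forall>c y z. blinfun_apply (\<Phi> (sY c y)) z = c * blinfun_apply (\<Phi> y) z) \<and>
    (\<forall>y. norm (\<Phi> y) = norm y) \<and>
    range \<Phi> = {\<phi>. bounded_operator sZ (*) \<phi>}"

lemma is_dual_via_id:
  "is_dual_via scaleR scaleR (id :: ('z::real_normed_vector \<Rightarrow>\<^sub>L real) \<Rightarrow> _)"
proof -
  have "((*) :: real \<Rightarrow> real \<Rightarrow> real) = scaleR"
    by (intro ext) simp
  then have "bounded_operator scaleR (*) \<phi>" for \<phi> :: "'z \<Rightarrow>\<^sub>L real"
    using bounded_operator_scaleR[of \<phi>] by simp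
  then show ?thesis
    by (simp add: is_dual_via_def scaleR_blinfun.rep_eq)
qed

definition weak_operator_limit ::
  "('k::{real_normed_field,heine_borel} \<Rightarrow> 'y::real_normed_vector \<Rightarrow> 'y) \<Rightarrow>
   (nat \<Rightarrow> ('x::real_normed_vector \<Rightarrow>\<^sub>L 'y)) \<Rightarrow> ('x \<Rightarrow>\<^sub>L 'y) \<Rightarrow> bool"
  where "weak_operator_limit sY S T \<longleftrightarrow>
    (\<forall>x f. bounded_operator sY (*) f \<longrightarrow>
      (\<lambda>n. blinfun_apply f (blinfun_apply (S n) x)) \<longlonglongrightarrow> blinfun_apply f (blinfun_apply T x))"

text \<open>Meaningful for \<open>k \<ge> 1\<close> only: for \<open>k = 0\<close> the infimum is over the empty set.\<close>

definition entropy_number ::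
  "nat \<Rightarrow> ('a::real_normed_vector \<Rightarrow>\<^sub>L 'b::real_normed_vector) \<Rightarrow> real"
  where "entropy_number k S =
    Inf {\<epsilon>. \<epsilon> > 0 \<and> (\<exists>j\<le>k. \<exists>y :: nat \<Rightarrow> 'b.
      blinfun_apply S ` cball 0 1 \<subseteq> (\<Union>i\<in>{1..j}. cball (y i) \<epsilon>))}"

end

theory Submission
  imports Defs
begin

text \<open>
  An \<open>\<epsilon>\<close>-cover of \<open>T (U\<^sub>X)\<close> by \<open>k\<close> balls is transported by \<open>Q\<^sub>n\<close> and the factor \<open>\<parallel>P\<^sub>n\<parallel>\<close> to such a
  cover of \<open>T\<^sub>n (U\<^sub>X)\<close>, so \<open>\<epsilon>\<^sub>k(T\<^sub>n) \<le> \<epsilon>\<^sub>k(T)\<close>. Conversely, if \<open>\<epsilon>\<^sub>k(T\<^sub>n) < \<epsilon>\<close> for infinitely many \<open>n\<close>,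
  the centres of the corresponding covers may be chosen in a fixed ball of the dual space \<open>Y\<close>, so
  they have a weak* cluster point. For each \<open>x \<in> U\<^sub>X\<close> one of the \<open>k\<close> indices serves \<open>T\<^sub>n x\<close>
  frequently, and weak* lower semicontinuity of the norm puts \<open>T x\<close> into the ball around the
  limiting centre. Hence \<open>\<epsilon>\<^sub>k(T) \<le> \<epsilon>\<close>. Cluster points are taken along filters rather than
  sequences, which makes Tychonoff's theorem directly applicable.
\<close>

section \<open>Radii of covers of the image of the unit ball\<close>

definition cover_radii ::
  "nat \<Rightarrow> ('a::real_normed_vector \<Rightarrow>\<^sub>L 'b::real_normed_vector) \<Rightarrow> real set"
  where "cover_radii k S =
    {\<epsilon>. \<epsilon> > 0 \<and> (\<exists>j\<le>k. \<exists>y :: nat \<Rightarrow> 'b.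
      blinfun_apply S ` cball 0 1 \<subseteq> (\<Union>i\<in>{1..j}. cball (y i) \<epsilon>))}"

lemma entropy_number_eq_Inf: "entropy_number k S = Inf (cover_radii k S)"
  by (simp add: entropy_number_def cover_radii_def)

lemma cover_radiiI:
  fixes S :: "'a::real_normed_vector \<Rightarrow>\<^sub>L 'b::real_normed_vector"
  assumes "\<epsilon> > 0"
    and "\<And>x. norm x \<le> 1 \<Longrightarrow> \<exists>i\<in>{1..k}. norm (S x - y i) \<le> \<epsilon>"
  shows "\<epsilon> \<in> cover_radii k S"
  using assms unfolding cover_radii_def
  by (force simp: dist_norm norm_minus_commute intro!: exI[of _ k] exI[of _ y])

lemma norm_blinfun_le_unit:
  assumes "norm x \<le> 1"
  shows "norm (blinfun_apply S x) \<le> norm S"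
  using norm_blinfun[of S x] mult_left_mono[OF assms norm_ge_zero[of S]] by simp

text \<open>A ball of radius \<open>\<epsilon>\<close> that meets the image of the unit ball has its
  centre within \<open>norm S + \<epsilon>\<close> of the origin. This bound is what later lets
  compactness act on the centres, and the common index set \<open>{1..k}\<close> lets covers of
  different operators be compared index by index.\<close>

lemma cover_radii_bounded_centres:
  fixes S :: "'a::real_normed_vector \<Rightarrow>\<^sub>L 'b::real_normed_vector"
  assumes "\<epsilon> \<in> cover_radii k S"
  obtains y :: "nat \<Rightarrow> 'b"
  where "\<And>i. norm (y i) \<le> norm S + \<epsilon>"
    and "\<And>x. norm x \<le> 1 \<Longrightarrow> \<exists>i\<in>{1..k}. norm (S x - y i) \<le> \<epsilon>"
proof -
  obtain j and y :: "nat \<Rightarrow> 'b" where "\<epsilon> > 0" "j \<le> k"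
    and y: "blinfun_apply S ` cball 0 1 \<subseteq> (\<Union>i\<in>{1..j}. cball (y i) \<epsilon>)"
    using assms by (auto simp: cover_radii_def)
  \<comment> \<open>A centre beyond this bound belongs to a ball that misses the image, so moving it
    to \<open>0\<close> uncovers nothing.\<close>
  define y' where "y' = (\<lambda>i. if norm (y i) \<le> norm S + \<epsilon> then y i else 0)"
  have "norm (y' i) \<le> norm S + \<epsilon>" for i
    using \<open>\<epsilon> > 0\<close> by (simp add: y'_def add_nonneg_nonneg)
  moreover have "\<exists>i\<in>{1..k}. norm (S x - y' i) \<le> \<epsilon>" if "norm x \<le> 1" for x
  proof -
    have "S x \<in> (\<Union>i\<in>{1..j}. cball (y i) \<epsilon>)"
      using that by (intro subsetD[OF y] imageI) simp
    then obtain i where i: "i \<in> {1..j}" "norm (S x - y i) \<le> \<epsilon>"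
      by (auto simp: dist_norm norm_minus_commute)
    then have "norm (y i) \<le> norm S + \<epsilon>"
      using norm_triangle_sub[of "y i" "S x"] norm_blinfun_le_unit[OF that, of S]
      by (simp add: norm_minus_commute)
    then show ?thesis
      using i \<open>j \<le> k\<close> by (auto simp: y'_def intro!: bexI[of _ i])
  qed
  ultimately show ?thesis
    using that by blast
qed

lemma cover_radii_mono:
  assumes "\<epsilon> \<in> cover_radii k S" "\<epsilon> \<le> \<delta>"
  shows "\<delta> \<in> cover_radii k S"
proof -
  obtain y where "\<And>x. norm x \<le> 1 \<Longrightarrow> \<exists>i\<in>{1..k}. norm (S x - y i) \<le> \<epsilon>"
    using assms(1) by (rule cover_radii_bounded_centres) blast
  moreover have "\<delta> > 0"
    using assms by (auto simp: cover_radii_def)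
  ultimately show ?thesis
    using assms(2) by (intro cover_radiiI[of _ _ _ y]) force+
qed

lemma cover_radii_nonempty:
  assumes "k \<ge> 1"
  shows "norm S + 1 \<in> cover_radii k S"
proof (rule cover_radiiI[where y = "\<lambda>_. 0"])
  show "\<exists>i\<in>{1..k}. norm (S x - 0) \<le> norm S + 1" if "norm x \<le> 1" for x
    using norm_blinfun_le_unit[OF that, of S] assms by (auto intro!: bexI[of _ 1])
qed (simp add: add_nonneg_pos)

lemma bdd_below_cover_radii: "bdd_below (cover_radii k S)"
  by (rule bdd_belowI[of _ 0]) (auto simp: cover_radii_def)

text \<open>\<open>P\<close> maps the unit ball into \<open>norm P\<close> times the unit ball.
  Pulling that factor out and applying \<open>Q\<close> to a cover for \<open>T\<close> multiplies
  the radius by at most \<open>norm Q * norm P\<close>.\<close>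

lemma cover_radii_compose:
  fixes P :: "'a::real_normed_vector \<Rightarrow>\<^sub>L 'b::real_normed_vector"
    and T :: "'b \<Rightarrow>\<^sub>L 'c::real_normed_vector" and Q :: "'c \<Rightarrow>\<^sub>L 'd::real_normed_vector"
  assumes "norm Q * norm P \<le> 1"
  shows "cover_radii k T \<subseteq> cover_radii k (Q o\<^sub>L T o\<^sub>L P)"
proof
  fix \<epsilon> assume \<epsilon>: "\<epsilon> \<in> cover_radii k T"
  then have "\<epsilon> > 0"
    by (simp add: cover_radii_def)
  from \<epsilon> obtain y where y: "\<And>x. norm x \<le> 1 \<Longrightarrow> \<exists>i\<in>{1..k}. norm (T x - y i) \<le> \<epsilon>"
    by (rule cover_radii_bounded_centres) blast
  show "\<epsilon> \<in> cover_radii k (Q o\<^sub>L T o\<^sub>L P)"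
  proof (rule cover_radiiI[where y = "\<lambda>i. norm P *\<^sub>R Q (y i)"])
    fix x :: 'a assume x: "norm x \<le> 1"
    \<comment> \<open>For \<open>P = 0\<close> the convention \<open>inverse 0 = 0\<close> gives
      \<open>u = 0\<close>, so the next two facts hold in that case as well.\<close>
    define u where "u = P x /\<^sub>R norm P"
    have Px: "P x = norm P *\<^sub>R u"
      by (cases "P = 0") (simp_all add: u_def)
    have "norm u \<le> 1"
      using norm_blinfun_le_unit[OF x, of P]
      by (cases "P = 0") (simp_all add: u_def divide_simps)
    then obtain i where i: "i \<in> {1..k}" "norm (T u - y i) \<le> \<epsilon>"
      using y by blast
    have "norm ((Q o\<^sub>L T o\<^sub>L P) x - norm P *\<^sub>R Q (y i)) = norm P * norm (Q (T u - y i))"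
      by (simp add: Px blinfun.scaleR_right blinfun.diff_right flip: scaleR_diff_right)
    also have "\<dots> \<le> norm P * (norm Q * \<epsilon>)"
      by (intro mult_left_mono order_trans[OF norm_blinfun] i) auto
    also have "\<dots> \<le> 1 * \<epsilon>"
      using mult_right_mono[OF assms less_imp_le[OF \<open>\<epsilon> > 0\<close>]] by (simp add: mult_ac)
    finally show "\<exists>i\<in>{1..k}. norm ((Q o\<^sub>L T o\<^sub>L P) x - norm P *\<^sub>R Q (y i)) \<le> \<epsilon>"
      using i by auto
  qed fact
qed

section \<open>Cluster points and weak* compactness\<close>

text \<open>The finer filter \<open>G\<close> takes the place of a convergent subnet: it combines
  \<open>F\<close> with the preimages under \<open>c\<close> of the neighbourhoods of a cluster
  point.\<close>

lemma compact_cluster_filter: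
  fixes c :: "'n \<Rightarrow> 'a::topological_space"
  assumes "compact K" "F \<noteq> bot" "eventually (\<lambda>n. c n \<in> K) F"
  obtains x G where "x \<in> K" "G \<le> F" "G \<noteq> bot" "(c \<longlongrightarrow> x) G"
proof -
  have "filtermap c F \<noteq> bot" "eventually (\<lambda>a. a \<in> K) (filtermap c F)"
    using assms by (simp_all add: filtermap_bot_iff eventually_filtermap)
  then obtain x where x: "x \<in> K" "inf (nhds x) (filtermap c F) \<noteq> bot"
    using \<open>compact K\<close> unfolding compact_filter by blast
  define G where "G = inf (filtercomap c (nhds x)) F"
  have "G \<noteq> bot"
  \<comment> \<open>If \<open>G\<close> were trivial, \<open>c\<close> would eventually avoid some
    neighbourhood of \<open>x\<close> along \<open>F\<close>, so \<open>x\<close> would not be a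
    cluster point.\<close>
  proof
    assume "G = bot"
    then have "eventually (\<lambda>_. False) G"
      by simp
    then obtain A B where A: "eventually A (nhds x)" and B: "eventually B F"
      and disj: "\<And>n. A (c n) \<Longrightarrow> B n \<Longrightarrow> False"
      unfolding G_def eventually_inf eventually_filtercomap by blast
    have "eventually (\<lambda>a. \<not> A a) (filtermap c F)"
      unfolding eventually_filtermap using B by eventually_elim (use disj in blast)
    with A have "eventually (\<lambda>_. False) (inf (nhds x) (filtermap c F))"
      unfolding eventually_inf by blast
    with x(2) show False
      by (simp add: trivial_limit_def)
  qed
  moreover have "(c \<longlongrightarrow> x) G"
    unfolding G_def by (rule filterlim_mono[OF filterlim_filtercomap order_refl inf_le1])
  moreover have "G \<le> F"
    by (simp add: G_def)
  ultimately show ?thesis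
    using that x(1) by blast
qed

text \<open>Tychonoff: the set is a product of closed balls, each compact by the Heine-Borel
  property, and the topology on functions is that of pointwise convergence.\<close>

lemma compact_pointwise_cball:
  "compact {f :: 'i \<Rightarrow> 'a::{real_normed_vector,heine_borel}. \<forall>i. norm (f i) \<le> r i}"
proof -
  have "{f :: 'i \<Rightarrow> 'a. \<forall>i. norm (f i) \<le> r i} = PiE UNIV (\<lambda>i. cball 0 (r i))"
    by (auto simp: PiE_def Pi_def)
  then show ?thesis
    using compactin_PiE[of "\<lambda>_. euclidean :: 'a topology" UNIV "\<lambda>i::'i. cball 0 (r i)"]
    by (simp add: euclidean_product_topology)
qed

lemma tendsto_apply:
  fixes c :: "'n \<Rightarrow> 'i \<Rightarrow> 'a::topological_space"
  assumes "(c \<longlongrightarrow> f) G"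
  shows "((\<lambda>n. c n i) \<longlongrightarrow> f i) G"
  using continuous_on_tendsto_compose[OF continuous_on_product_coordinates assms] by simp

lemma is_dual_via_diff:
  assumes "is_dual_via sY sZ \<Phi>"
  shows "\<Phi> (a - b) = \<Phi> a - \<Phi> b"
proof -
  have "\<Phi> (a - b + b) = \<Phi> (a - b) + \<Phi> b"
    using assms by (simp only: is_dual_via_def)
  then show ?thesis
    by simp
qed

lemma normed_space_over_linearI:
  assumes "normed_space_over s" "normed_space_over t"
    and "\<And>a b. f (a + b) = f a + f b" "\<And>c a. f (s c a) = t c (f a)"
  shows "Vector_Spaces.linear s t f"
  using assms by (simp add: Vector_Spaces.linear_iff normed_space_over_def)

text \<open>Evaluations at points of the predual are admissible test functionals for the weak
  operator topology. This is how weak convergence in the dual yields weak* convergence.\<close>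

lemma bounded_operator_evaluation:
  fixes \<Phi> :: "'y::real_normed_vector \<Rightarrow> 'z::real_normed_vector \<Rightarrow>\<^sub>L 'k::{real_normed_field,heine_borel}"
  assumes dual: "is_dual_via sY sZ \<Phi>" and Y: "normed_space_over sY"
  obtains e where "bounded_operator sY (*) e" "\<And>y. blinfun_apply e y = \<Phi> y z"
proof -
  interpret Y: normed_space_over sY by (fact Y)
  have add: "\<Phi> (a + b) z = \<Phi> a z + \<Phi> b z" and scale: "\<Phi> (sY c a) z = c * \<Phi> a z"
    and norm: "norm (\<Phi> a) = norm a" for a b c
    using dual by (simp_all add: is_dual_via_def blinfun.add_left)
  have bl: "bounded_linear (\<lambda>y. \<Phi> y z)"
  proof (rule bounded_linear_intro[where K = "norm z"])
    show "\<Phi> (r *\<^sub>R a) z = r *\<^sub>R \<Phi> a z" for r a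
      using scale[of "of_real r" a] by (simp add: Y.scale_of_real scaleR_conv_of_real)
    show "norm (\<Phi> a z) \<le> norm a * norm z" for a
      using norm_blinfun[of "\<Phi> a" z] by (simp add: norm)
  qed (fact add)
  have "Vector_Spaces.linear sY (*) (\<lambda>y. \<Phi> y z)"
    using Y normed_space_over_mult add scale by (rule normed_space_over_linearI)
  with bl that[of "Blinfun (\<lambda>y. \<Phi> y z)"] show ?thesis
    by (simp add: bounded_operator_def bounded_linear_Blinfun_apply)
qed

text \<open>Banach-Alaoglu for a whole family of functionals at once, with one filter
  \<open>G\<close> serving every index \<open>i\<close>.\<close>

lemma weak_star_cluster:
  fixes \<Phi> :: "'y::real_normed_vector \<Rightarrow> 'z::real_normed_vector \<Rightarrow>\<^sub>L 'k::{real_normed_field,heine_borel}"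
    and y :: "'n \<Rightarrow> 'i \<Rightarrow> 'y"
  assumes dual: "is_dual_via sY sZ \<Phi>" and Z: "normed_space_over sZ"
    and F: "F \<noteq> bot" and bdd: "eventually (\<lambda>n. \<forall>i. norm (y n i) \<le> M) F"
  obtains w G where "G \<le> F" "G \<noteq> bot" "\<And>i z. ((\<lambda>n. \<Phi> (y n i) z) \<longlongrightarrow> \<Phi> (w i) z) G"
proof -
  interpret Z: normed_space_over sZ by (fact Z)
  have norm: "norm (\<Phi> a) = norm a" and bop: "bounded_operator sZ (*) (\<Phi> a)" for a
    using dual by (auto simp: is_dual_via_def)
  have scale: "\<Phi> a (sZ c z) = c * \<Phi> a z" for a c z
    using bop[of a] by (simp add: bounded_operator_def Vector_Spaces.linear_iff)
  \<comment> \<open>All values of all members of the family form a single point of a product of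
    scalar balls indexed by pairs \<open>(i, z)\<close>.\<close>
  define c where "c = (\<lambda>n (i, z). \<Phi> (y n i) z)"
  have "eventually (\<lambda>n. c n \<in> {f. \<forall>iz. norm (f iz) \<le> M * norm (snd iz)}) F"
    using bdd
  proof eventually_elim
    case (elim n)
    have "norm (\<Phi> (y n i) z) \<le> M * norm z" for i z
      using norm_blinfun[of "\<Phi> (y n i)" z] elim
      by (metis norm mult_right_mono norm_ge_zero order_trans)
    then show ?case
      by (auto simp: c_def)
  qed
  then obtain f G where f: "f \<in> {f. \<forall>iz. norm (f iz) \<le> M * norm (snd iz)}"
    and G: "G \<le> F" "G \<noteq> bot" and "(c \<longlongrightarrow> f) G"
    by (rule compact_cluster_filter[OF compact_pointwise_cball F])
  then have lim: "((\<lambda>n. \<Phi> (y n i) z) \<longlongrightarrow> f (i, z)) G" for i z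
    using tendsto_apply[of c f G "(i, z)"] by (simp add: c_def)
  \<comment> \<open>Linearity and the bound \<open>M\<close> survive pointwise limits, and every
    bounded functional lies in the range of \<open>\<Phi>\<close>.\<close>
  have "\<exists>w. \<forall>z. \<Phi> w z = f (i, z)" for i
  proof -
    have add: "f (i, a + b) = f (i, a) + f (i, b)" for a b
      using tendsto_unique[OF G(2) lim[of i "a + b"]] tendsto_add[OF lim[of i a] lim[of i b]]
      by (simp add: blinfun.add_right)
    have sc: "f (i, sZ r a) = r * f (i, a)" for r a
      using tendsto_unique[OF G(2) lim[of i "sZ r a"]] tendsto_mult_left[OF lim[of i a], of r]
      by (simp add: scale)
    have bl: "bounded_linear (\<lambda>z. f (i, z))"
    proof (rule bounded_linear_intro[where K = M])
      show "f (i, r *\<^sub>R a) = r *\<^sub>R f (i, a)" for r a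
        using sc[of "of_real r" a] by (simp add: Z.scale_of_real scaleR_conv_of_real)
      show "norm (f (i, a)) \<le> norm a * M" for a
        using f by (auto simp: mult.commute)
    qed (fact add)
    have "Vector_Spaces.linear sZ (*) (\<lambda>z. f (i, z))"
      using Z normed_space_over_mult add sc by (rule normed_space_over_linearI)
    with bl have "bounded_operator sZ (*) (Blinfun (\<lambda>z. f (i, z)))"
      by (simp add: bounded_operator_def bounded_linear_Blinfun_apply)
    then have "Blinfun (\<lambda>z. f (i, z)) \<in> range \<Phi>"
      using dual by (simp add: is_dual_via_def)
    then show ?thesis
      using bounded_linear_Blinfun_apply[OF bl] by (metis rangeE)
  qed
  then obtain w where "\<And>i z. \<Phi> (w i) z = f (i, z)"
    by metis
  with lim G show ?thesis
    by (intro that[of G w]) simp_all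
qed

section \<open>Passing to the limit in the covers\<close>

text \<open>If the limit exceeded the bound at some \<open>z\<close>, then \<open>v n\<close> would
  eventually exceed it there, which contradicts the bound holding frequently.\<close>

lemma norm_le_weak_star_limit:
  fixes \<Phi> :: "'y::real_normed_vector \<Rightarrow> 'z::real_normed_vector \<Rightarrow>\<^sub>L 'k::{real_normed_field,heine_borel}"
  assumes dual: "is_dual_via sY sZ \<Phi>"
    and lim: "\<And>z. ((\<lambda>n. \<Phi> (v n) z) \<longlongrightarrow> \<Phi> w z) G"
    and freq: "frequently (\<lambda>n. norm (v n) \<le> \<epsilon>) G" and "\<epsilon> \<ge> 0"
  shows "norm w \<le> \<epsilon>"
proof -
  have norm: "norm (\<Phi> a) = norm a" for a
    using dual by (simp add: is_dual_via_def)
  have "norm (\<Phi> w z) \<le> \<epsilon> * norm z" for z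
  proof (rule ccontr)
    assume "\<not> norm (\<Phi> w z) \<le> \<epsilon> * norm z"
    then have "eventually (\<lambda>n. norm (\<Phi> (v n) z) > \<epsilon> * norm z) G"
      using order_tendstoD(1)[OF tendsto_norm[OF lim]] by simp
    then obtain n where n: "norm (v n) \<le> \<epsilon>" "norm (\<Phi> (v n) z) > \<epsilon> * norm z"
      using frequently_ex[OF frequently_eventually_conj[OF freq]] by blast
    have "norm (\<Phi> (v n) z) \<le> norm (v n) * norm z"
      using norm_blinfun[of "\<Phi> (v n)" z] by (simp add: norm)
    also have "\<dots> \<le> \<epsilon> * norm z"
      using n(1) by (rule mult_right_mono) simp
    finally show False
      using n(2) by simp
  qed
  then show ?thesis
    using norm_blinfun_bound[OF \<open>\<epsilon> \<ge> 0\<close>, of "\<Phi> w"] by (simp add: norm)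
qed

lemma cover_radii_weak_star_limit:
  fixes \<Phi> :: "'y::real_normed_vector \<Rightarrow> 'z::real_normed_vector \<Rightarrow>\<^sub>L 'k::{real_normed_field,heine_borel}"
    and S :: "'n \<Rightarrow> 'x::real_normed_vector \<Rightarrow>\<^sub>L 'y" and T :: "'x \<Rightarrow>\<^sub>L 'y"
  assumes dual: "is_dual_via sY sZ \<Phi>" and Z: "normed_space_over sZ" and F: "F \<noteq> bot"
    and bdd: "eventually (\<lambda>n. norm (S n) \<le> M) F"
    and lim: "\<And>x z. ((\<lambda>n. \<Phi> (S n x) z) \<longlongrightarrow> \<Phi> (T x) z) F"
    and radii: "eventually (\<lambda>n. \<epsilon> \<in> cover_radii k (S n)) F"
  shows "\<epsilon> \<in> cover_radii k T"
proof -
  have "\<epsilon> > 0"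
    using eventually_happens'[OF F radii] by (auto simp: cover_radii_def)
  define good where "good = (\<lambda>n (y :: nat \<Rightarrow> 'y). (\<forall>i. norm (y i) \<le> norm (S n) + \<epsilon>) \<and>
    (\<forall>x. norm x \<le> 1 \<longrightarrow> (\<exists>i\<in>{1..k}. norm (S n x - y i) \<le> \<epsilon>)))"
  \<comment> \<open>The choice is meaningful only where \<open>\<epsilon>\<close> is admissible for
    \<open>S n\<close>, which is eventually the case along \<open>F\<close>.\<close>
  define y where "y = (\<lambda>n. SOME y. good n y)"
  have good: "eventually (\<lambda>n. good n (y n)) F"
    using radii
  proof eventually_elim
    case (elim n)
    then have "\<exists>y. good n y"
      unfolding good_def by (rule cover_radii_bounded_centres) blast
    then show ?case
      unfolding y_def by (rule someI_ex)
  qed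
  have "eventually (\<lambda>n. \<forall>i. norm (y n i) \<le> M + \<epsilon>) F"
    using good bdd
    by eventually_elim (auto simp: good_def intro: order_trans[OF _ add_right_mono])
  then obtain G w where G: "G \<le> F" "G \<noteq> bot"
    and w: "\<And>i z. ((\<lambda>n. \<Phi> (y n i) z) \<longlongrightarrow> \<Phi> (w i) z) G"
    by (rule weak_star_cluster[OF dual Z F]) (rule that)
  show ?thesis
  proof (rule cover_radiiI[where y = w])
    fix x :: 'x assume x: "norm x \<le> 1"
    have "eventually (\<lambda>n. \<exists>i\<in>{1..k}. norm (S n x - y n i) \<le> \<epsilon>) G"
      using filter_leD[OF G(1) good] by eventually_elim (use x in \<open>auto simp: good_def\<close>)
    \<comment> \<open>Pigeonhole over finitely many indices. The index \<open>i\<close> may depend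
      on \<open>x\<close>, but the filter \<open>G\<close> and the limiting centres \<open>w\<close>
      do not.\<close>
    then have "\<exists>i\<in>{1..k}. frequently (\<lambda>n. norm (S n x - y n i) \<le> \<epsilon>) G"
      by (intro frequently_bex_finite eventually_frequently G(2) finite_atLeastAtMost)
    then obtain i where i: "i \<in> {1..k}" "frequently (\<lambda>n. norm (S n x - y n i) \<le> \<epsilon>) G"
      by blast
    have "((\<lambda>n. \<Phi> (S n x - y n i) z) \<longlongrightarrow> \<Phi> (T x - w i) z) G" for z
      using tendsto_diff[OF tendsto_mono[OF G(1) lim] w]
      by (simp add: is_dual_via_diff[OF dual] blinfun.diff_left)
    then have "norm (T x - w i) \<le> \<epsilon>"
      using norm_le_weak_star_limit[OF dual _ i(2)] \<open>\<epsilon> > 0\<close> by simp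
    then show "\<exists>i\<in>{1..k}. norm (T x - w i) \<le> \<epsilon>"
      using i(1) by blast
  qed fact
qed

section \<open>Convergence of the entropy numbers\<close>

theorem corollary2p5:
  fixes sX :: "'k::{real_normed_field,heine_borel} \<Rightarrow> 'x::real_normed_vector \<Rightarrow> 'x"
    and sY :: "'k \<Rightarrow> 'y::real_normed_vector \<Rightarrow> 'y"
    and sZ :: "'k \<Rightarrow> 'z::banach \<Rightarrow> 'z"
    and \<Phi> :: "'y \<Rightarrow> 'z \<Rightarrow>\<^sub>L 'k"
    and T :: "'x \<Rightarrow>\<^sub>L 'y"
    and P :: "nat \<Rightarrow> 'x \<Rightarrow>\<^sub>L 'x"
    and Q :: "nat \<Rightarrow> 'y \<Rightarrow>\<^sub>L 'y"
    and k :: nat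
  assumes "normed_space_over sX" and "normed_space_over sY" and "normed_space_over sZ"
    and "separable_space (euclidean :: 'z topology)"
    and "is_dual_via sY sZ \<Phi>"
    and "bounded_operator sX sY T"
    and "\<And>n. bounded_operator sX sX (P n)"
    and "\<And>n. bounded_operator sY sY (Q n)"
    and "\<And>n. norm (Q n) * norm (P n) \<le> 1"
    and "weak_operator_limit sY (\<lambda>n. Q n o\<^sub>L T o\<^sub>L P n) T"
    and "k \<ge> 1"
  shows "(\<lambda>n. entropy_number k (Q n o\<^sub>L T o\<^sub>L P n)) \<longlonglongrightarrow> entropy_number k T"
proof (rule order_tendstoI)
  note Y = assms(2) and Z = assms(3) and dual = assms(5)
    and norms = assms(9) and lim = assms(10) and k = assms(11)
  let ?S = "\<lambda>n. Q n o\<^sub>L T o\<^sub>L P n"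
  \<comment> \<open>Enlarging the set of admissible radii lowers its infimum; the set for
    \<open>T\<close> is nonempty because \<open>k \<ge> 1\<close>.\<close>
  have le: "entropy_number k (?S n) \<le> entropy_number k T" for n
    unfolding entropy_number_eq_Inf
    using cover_radii_nonempty[OF k, of T]
    by (intro cInf_superset_mono bdd_below_cover_radii cover_radii_compose norms) auto
  show "eventually (\<lambda>n. entropy_number k (?S n) < a) sequentially"
    if "entropy_number k T < a" for a
    using le that by (intro always_eventually allI) (rule le_less_trans)
  show "eventually (\<lambda>n. a < entropy_number k (?S n)) sequentially"
    if a: "a < entropy_number k T" for a
  proof (rule ccontr)
    assume not: "\<not> ?thesis"
    \<comment> \<open>The infimum need not be attained. The gap above \<open>a\<close> makes this
      one \<open>\<epsilon>\<close> admissible for every \<open>n\<close> in the set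
      \<open>A\<close> below.\<close>
    obtain \<epsilon> where \<epsilon>: "a < \<epsilon>" "\<epsilon> < entropy_number k T"
      using dense[OF a] by blast
    define A where "A = {n. entropy_number k (?S n) \<le> a}"
    \<comment> \<open>\<open>F\<close> follows the sequence along the indices that violate the lower
      bound; it is proper because these occur infinitely often.\<close>
    define F where "F = inf sequentially (principal A)"
    have F: "F \<noteq> bot"
      using not by (simp add: F_def A_def trivial_limit_def eventually_inf_principal not_le)
    have "F \<le> sequentially"
      by (simp add: F_def)
    have "\<epsilon> \<in> cover_radii k (?S n)" if "n \<in> A" for n
    proof -
      have "Inf (cover_radii k (?S n)) < \<epsilon>"
        using that \<epsilon>(1) by (simp add: A_def flip: entropy_number_eq_Inf)
      then obtain \<delta> where "\<delta> \<in> cover_radii k (?S n)" "\<delta> < \<epsilon>"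
        using cInf_lessD cover_radii_nonempty[OF k] by (metis empty_iff)
      then show ?thesis
        using cover_radii_mono by fastforce
    qed
    then have radii: "eventually (\<lambda>n. \<epsilon> \<in> cover_radii k (?S n)) F"
      by (simp add: F_def eventually_inf_principal)
    have "norm (?S n) \<le> norm T" for n
    proof -
      have "norm (?S n) \<le> norm (Q n) * norm T * norm (P n)"
        by (meson norm_blinfun_compose mult_right_mono norm_ge_zero order_trans)
      also have "\<dots> \<le> norm T"
        using mult_right_mono[OF norms[of n] norm_ge_zero[of T]] by (simp add: mult_ac)
      finally show ?thesis .
    qed
    then have bdd: "eventually (\<lambda>n. norm (?S n) \<le> norm T) F"
      by simp
    have "((\<lambda>n. \<Phi> (?S n x) z) \<longlongrightarrow> \<Phi> (T x) z) F" for x z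
    proof -
      obtain e where e: "bounded_operator sY (*) e" "\<And>y. blinfun_apply e y = \<Phi> y z"
        using bounded_operator_evaluation[OF dual Y] by metis
      have "(\<lambda>n. \<Phi> (?S n x) z) \<longlonglongrightarrow> \<Phi> (T x) z"
        using lim[unfolded weak_operator_limit_def, rule_format, OF e(1), of x]
        unfolding e(2) .
      then show ?thesis
        by (rule tendsto_mono[OF \<open>F \<le> sequentially\<close>])
    qed
    from cover_radii_weak_star_limit[OF dual Z F bdd this radii]
    have "entropy_number k T \<le> \<epsilon>"
      unfolding entropy_number_eq_Inf by (rule cInf_lower[OF _ bdd_below_cover_radii])
    with \<epsilon>(2) show False
      by simp
  qed
qed

end
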